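(* Let $m\ge 1$ and $U=\mathrm{Mat}_m$, the space of complex $m\times m$ matrices. For generic $(a_1,a_2)\in U\times U$ define $\mu(a_1,a_2)=(b_1,b_2)$, where $(b_1,b_2)\in U\times U$ is determined by $$b_1+b_2=a_1+a_2,\qquad b_1b_2=a_1a_2,\qquad S(b_1)=S(a_2),\qquad S(b_2)=S(a_1).$$ Then $\mu$ is a twisted transposition of $U$. Explicitly, $$\mu(a_1,a_2)=(a_1+\Lambda^{-1},\;a_2-\Lambda^{-1}),$$ where $\Lambda\in \mathrm{Mat}_m$ is the solution of the linear matrix equation $a_2\Lambda-\Lambda a_1=1$ (here $1$ is the identity matrix).
   Context: $\mathrm{Mat}_m$ is the algebra of complex $m\times m$ matrices, and $S(a)$ denotes the set of eigenvalues of $a\in\mathrm{Mat}_m$. "Generic" means: for all points of some nonempty Zariski-open subset of the parameter space (here $\mathrm{Mat}_m\times\mathrm{Mat}_m$). Let $U$ be a complex manifold and $\mu:U\times U\to U\times U$ a birational automorphism of $U\times U$. Define birational automorphisms of $U\times U\times U$ by $\sigma_1=\mu\times\mathrm{id}$ ($\mu$ acting on the first two factors) and $\sigma_2=\mathrm{id}\times\mu$ ($\mu$ acting on the last two factors). The map $\mu$ is called a twisted transposition if $$\sigma_1^2=\sigma_2^2=\mathrm{id},\qquad \sigma_1\sigma_2\sigma_1=\sigma_2\sigma_1\sigma_2$$ as birational automorphisms of $U\times U\times U$ (i.e. wherever the compositions are defined, on a dense open subset). *)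

theory Defs
  imports "HOL-Analysis.Analysis"
begin

text \<open>
  An affine space over the complex numbers is a type with a finite set of coordinate functions
  that identify it with the space of all complex-valued families indexed by these functions.
\<close>

class complex_affine =
  fixes coordinates :: "('a \<Rightarrow> complex) set"
  assumes finite_coordinates: "finite coordinates"
    and ex1_coordinates: "\<exists>!x. \<forall>c\<in>coordinates. c x = g c"

instantiation complex :: complex_affine
begin

definition coordinates_complex :: "(complex \<Rightarrow> complex) set" where
  "coordinates_complex = {\<lambda>z. z}"

instance
  by standard (auto simp: coordinates_complex_def)

end

instantiation vec :: (complex_affine, finite) complex_affine
begin

definition coordinates_vec :: "('a ^ 'b \<Rightarrow> complex) set" where
  "coordinates_vec = (\<Union>i. (\<lambda>c v. c (v $ i)) ` coordinates)"

instance
proof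
  show "finite (coordinates :: ('a ^ 'b \<Rightarrow> complex) set)"
    by (simp add: coordinates_vec_def finite_coordinates)
next
  fix g :: "('a ^ 'b \<Rightarrow> complex) \<Rightarrow> complex"
  define y :: "'b \<Rightarrow> 'a"
    where "y i = (THE y. \<forall>c\<in>coordinates. c y = g (\<lambda>v. c (v $ i)))" for i
  have y: "\<forall>c\<in>coordinates. c (y i) = g (\<lambda>v. c (v $ i))" for i
    unfolding y_def by (rule theI') (rule ex1_coordinates)
  have unique: "z = y i" if "\<forall>c\<in>coordinates. c z = g (\<lambda>v. c (v $ i))" for i z
    unfolding y_def by (rule the1_equality[symmetric]) (rule ex1_coordinates, rule that)
  show "\<exists>!x. \<forall>c\<in>coordinates. c x = g c"
  proof (rule ex1I)
    show "\<forall>c\<in>coordinates. c (\<chi> i. y i) = g c"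
      using y by (auto simp: coordinates_vec_def)
  next
    fix x :: "'a ^ 'b"
    assume "\<forall>c\<in>coordinates. c x = g c"
    then have "x $ i = y i" for i
      by (intro unique) (auto simp: coordinates_vec_def)
    then show "x = (\<chi> i. y i)"
      by (simp add: vec_eq_iff)
  qed
qed

end

instantiation prod :: (complex_affine, complex_affine) complex_affine
begin

definition coordinates_prod :: "('a \<times> 'b \<Rightarrow> complex) set" where
  "coordinates_prod = (\<lambda>c. c \<circ> fst) ` coordinates \<union> (\<lambda>c. c \<circ> snd) ` coordinates"

instance
proof
  show "finite (coordinates :: ('a \<times> 'b \<Rightarrow> complex) set)"
    by (simp add: coordinates_prod_def finite_coordinates)
next
  fix g :: "('a \<times> 'b \<Rightarrow> complex) \<Rightarrow> complex"
  define y :: 'a where "y = (THE y. \<forall>c\<in>coordinates. c y = g (c \<circ> fst))"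
  have y: "\<forall>c\<in>coordinates. c y = g (c \<circ> fst)"
    unfolding y_def by (rule theI') (rule ex1_coordinates)
  have y_unique: "y' = y" if "\<forall>c\<in>coordinates. c y' = g (c \<circ> fst)" for y'
    unfolding y_def by (rule the1_equality[symmetric]) (rule ex1_coordinates, rule that)
  define z :: 'b where "z = (THE z. \<forall>c\<in>coordinates. c z = g (c \<circ> snd))"
  have z: "\<forall>c\<in>coordinates. c z = g (c \<circ> snd)"
    unfolding z_def by (rule theI') (rule ex1_coordinates)
  have z_unique: "z' = z" if "\<forall>c\<in>coordinates. c z' = g (c \<circ> snd)" for z'
    unfolding z_def by (rule the1_equality[symmetric]) (rule ex1_coordinates, rule that)
  show "\<exists>!x. \<forall>c\<in>coordinates. c x = g c"
  proof (rule ex1I)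
    show "\<forall>c\<in>coordinates. c (y, z) = g c"
      using y z by (auto simp: coordinates_prod_def)
  next
    fix x :: "'a \<times> 'b"
    assume x: "\<forall>c\<in>coordinates. c x = g c"
    have "fst x = y"
      using x by (intro y_unique) (auto simp: coordinates_prod_def)
    moreover have "snd x = z"
      using x by (intro z_unique) (auto simp: coordinates_prod_def)
    ultimately show "x = (y, z)"
      by (simp add: prod_eq_iff)
  qed
qed

end

inductive_set polynomial_functions :: "('a::complex_affine \<Rightarrow> complex) set" where
  coordinate: "c \<in> coordinates \<Longrightarrow> c \<in> polynomial_functions"
| const: "(\<lambda>x. k) \<in> polynomial_functions"
| add: "p \<in> polynomial_functions \<Longrightarrow> q \<in> polynomial_functions \<Longrightarrow>
    (\<lambda>x. p x + q x) \<in> polynomial_functions"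
| mult: "p \<in> polynomial_functions \<Longrightarrow> q \<in> polynomial_functions \<Longrightarrow>
    (\<lambda>x. p x * q x) \<in> polynomial_functions"

definition zariski_closed :: "'a::complex_affine set \<Rightarrow> bool" where
  "zariski_closed Z \<longleftrightarrow> (\<exists>P \<subseteq> polynomial_functions. Z = {x. \<forall>p\<in>P. p x = 0})"

definition zariski_open :: "'a::complex_affine set \<Rightarrow> bool" where
  "zariski_open V \<longleftrightarrow> zariski_closed (- V)"

definition generically :: "('a::complex_affine \<Rightarrow> bool) \<Rightarrow> bool" where
  "generically P \<longleftrightarrow> (\<exists>V. zariski_open V \<and> V \<noteq> {} \<and> (\<forall>x\<in>V. P x))"

definition regular_on :: "'a::complex_affine set \<Rightarrow> ('a \<Rightarrow> 'b::complex_affine) \<Rightarrow> bool" where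
  "regular_on V f \<longleftrightarrow> (\<forall>c\<in>coordinates. \<forall>x\<in>V. \<exists>p\<in>polynomial_functions. \<exists>q\<in>polynomial_functions.
     q x \<noteq> 0 \<and> (\<forall>y\<in>V. q y \<noteq> 0 \<longrightarrow> c (f y) = p y / q y))"

text \<open>
  Rational maps are represented by total functions whose values matter only on some nonempty
  Zariski open set, so equality of rational maps is generic equality of representatives.
  A birational map restricts to an isomorphism between nonempty Zariski open sets; hence the
  composition of representatives represents the composition of birational maps.
\<close>

definition birational :: "('a::complex_affine \<Rightarrow> 'b::complex_affine) \<Rightarrow> bool" where
  "birational f \<longleftrightarrow> (\<exists>V W g. zariski_open V \<and> V \<noteq> {} \<and> zariski_open W \<and> W \<noteq> {} \<and>
     regular_on V f \<and> regular_on W g \<and> f ` V \<subseteq> W \<and> g ` W \<subseteq> V \<and>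
     (\<forall>x\<in>V. g (f x) = x) \<and> (\<forall>y\<in>W. f (g y) = y))"

definition sigma1 :: "('a \<times> 'a \<Rightarrow> 'a \<times> 'a) \<Rightarrow> 'a \<times> 'a \<times> 'a \<Rightarrow> 'a \<times> 'a \<times> 'a" where
  "sigma1 \<mu> = (\<lambda>(x, y, z). let (x', y') = \<mu> (x, y) in (x', y', z))"

definition sigma2 :: "('a \<times> 'a \<Rightarrow> 'a \<times> 'a) \<Rightarrow> 'a \<times> 'a \<times> 'a \<Rightarrow> 'a \<times> 'a \<times> 'a" where
  "sigma2 \<mu> = (\<lambda>(x, y, z). let (y', z') = \<mu> (y, z) in (x, y', z'))"

definition twisted_transposition :: "('a::complex_affine \<times> 'a \<Rightarrow> 'a \<times> 'a) \<Rightarrow> bool" where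
  "twisted_transposition \<mu> \<longleftrightarrow> birational \<mu> \<and>
     generically (\<lambda>x. sigma1 \<mu> (sigma1 \<mu> x) = x) \<and>
     generically (\<lambda>x. sigma2 \<mu> (sigma2 \<mu> x) = x) \<and>
     generically (\<lambda>x. sigma1 \<mu> (sigma2 \<mu> (sigma1 \<mu> x)) = sigma2 \<mu> (sigma1 \<mu> (sigma2 \<mu> x)))"

definition eigenvalues :: "complex ^ 'n ^ 'n \<Rightarrow> complex set" where
  "eigenvalues a = {z. \<exists>v. v \<noteq> 0 \<and> a *v v = z *s v}"

definition swap_factors ::
    "(complex ^ 'n ^ 'n) \<times> (complex ^ 'n ^ 'n) \<Rightarrow> (complex ^ 'n ^ 'n) \<times> (complex ^ 'n ^ 'n) \<Rightarrow> bool" where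
  "swap_factors = (\<lambda>(a1, a2) (b1, b2).
     b1 + b2 = a1 + a2 \<and> b1 ** b2 = a1 ** a2 \<and>
     eigenvalues b1 = eigenvalues a2 \<and> eigenvalues b2 = eigenvalues a1)"

end

theory Submission
  imports Defs "HOL-Computational_Algebra.Fundamental_Theorem_Algebra"
begin

text \<open>
  Let \<open>a1\<close>, \<open>a2\<close> have disjoint spectra.  Writing \<open>b1 = a1 + D\<close>, \<open>b2 = a2 - D\<close>, the equation
  \<open>b1 b2 = a1 a2\<close> becomes \<open>D a2 = b1 D\<close>.  The kernel of \<open>D\<close> is therefore invariant under \<open>a2\<close>,
  and \<open>b2\<close> agrees with \<open>a2\<close> on it, so an eigenvector of \<open>a2\<close> in this kernel would give a common
  eigenvalue of \<open>a2\<close> and \<open>b2\<close>, hence of \<open>a2\<close> and \<open>a1\<close>.  Thus \<open>D\<close> is invertible, and its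
  inverse \<open>\<Lambda>\<close> solves the Sylvester equation \<open>a2 \<Lambda> - \<Lambda> a1 = 1\<close>
  (lemma \<open>swap_factors_sylvester_solution\<close>).  Conversely, if the solution \<open>\<Lambda>\<close> is invertible, then
  \<open>b1 = \<Lambda>\<inverse> a2 \<Lambda>\<close> and \<open>b2 = \<Lambda> a1 \<Lambda>\<inverse>\<close>, which shows that the spectra are exchanged.  For the
  pair \<open>(b1, b2)\<close> the solution is \<open>- \<Lambda>\<close>, so the exchange is an involution of the set of
  admissible pairs (lemma \<open>admissible_exchange\<close>).

  The Sylvester operator has an \<open>m\<^sup>2 \<times> m\<^sup>2\<close> matrix with polynomial entries.  By Cramer's rule the
  admissible pairs are the complement of one hypersurface \<open>g = 0\<close>, and the exchange has entries of
  the form \<open>p / g^k\<close> there (lemma \<open>exchange_localization\<close>).  An involution that is regular on such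
  a complement is birational, and properties that hold generically still hold generically after
  composition with it (locale \<open>rational_involution\<close>); this is what permits the composition of
  arbitrary representatives of the exchange.

  For the braid relation, both sides turn \<open>(a1, a2, a3)\<close> into the linear factors of the same monic
  cubic \<open>(t - a1) (t - a2) (t - a3)\<close>, with factors similar to \<open>a3\<close>, \<open>a2\<close>, \<open>a1\<close> in this order.
  Such a factorization is unique when the spectra are pairwise disjoint: if \<open>c\<close> is the last factor
  of one factorization, then substituting \<open>c\<close> from the right into the other one gives
  intertwining relations that force its last factor to be \<open>c\<close>
  (lemmas \<open>cubic_factorization_unique\<close> and \<open>exchange_braid\<close>).
\<close>

section \<open>Polynomial functions and generic points\<close>

lemma polynomial_functions_power:
  "p \<in> polynomial_functions \<Longrightarrow> (\<lambda>x. p x ^ k) \<in> polynomial_functions"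
  by (induction k) (auto intro: polynomial_functions.intros)

text \<open>
  The class of affine spaces provides coordinates but no vector space operations, so the affine
  line through two points is described by its coordinates.
\<close>

definition line :: "'a::complex_affine \<Rightarrow> 'a \<Rightarrow> complex \<Rightarrow> 'a" where
  "line x y t = (THE z. \<forall>c\<in>coordinates. c z = (1 - t) * c x + t * c y)"

lemma coordinate_line: "c \<in> coordinates \<Longrightarrow> c (line x y t) = (1 - t) * c x + t * c y"
  using theI'[OF ex1_coordinates[of "\<lambda>c. (1 - t) * c x + t * c y"]] by (simp add: line_def)

lemma coordinates_eqI: "x = y" if "\<And>c. c \<in> coordinates \<Longrightarrow> c x = c y"
  using ex1_coordinates[of "\<lambda>c. c y"] that by blast

lemma line_0: "line x y 0 = x" and line_1: "line x y 1 = y"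
  by (rule coordinates_eqI; simp add: coordinate_line)+

lemma polynomial_on_line:
  assumes "p \<in> polynomial_functions"
  shows "\<exists>P. \<forall>t. p (line x y t) = poly P t"
  using assms
proof induction
  case (coordinate c)
  then show ?case
    by (intro exI[of _ "[:c x, c y - c x:]"]) (simp add: coordinate_line algebra_simps)
next
  case (const k)
  then show ?case by (intro exI[of _ "[:k:]"]) simp
next
  case (add p q)
  then show ?case by (metis poly_add)
next
  case (mult p q)
  then show ?case by (metis poly_mult)
qed

text \<open>
  Irreducibility of affine space: on the line that joins the two points both functions become
  nonzero polynomials in one variable, and their product has only finitely many roots.
\<close>

lemma polynomial_functions_common_nonzero:
  assumes "p \<in> polynomial_functions" "q \<in> polynomial_functions" "p x \<noteq> 0" "q y \<noteq> 0"
  shows "\<exists>z. p z \<noteq> 0 \<and> q z \<noteq> 0"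
proof -
  obtain P Q where P: "\<And>t. p (line x y t) = poly P t" and Q: "\<And>t. q (line x y t) = poly Q t"
    using polynomial_on_line assms by metis
  have "poly P 0 \<noteq> 0" "poly Q 1 \<noteq> 0"
    using P Q assms line_0 line_1 by metis+
  then have "P * Q \<noteq> 0" by auto
  then have "finite {t. poly (P * Q) t = 0}" by (rule poly_roots_finite)
  then obtain t where "poly (P * Q) t \<noteq> 0"
    using infinite_UNIV_char_0 by (metis (mono_tags, lifting) UNIV_eq_I mem_Collect_eq)
  then show ?thesis using P Q by (metis mult_eq_0_iff poly_mult)
qed

lemma zariski_open_nonzero:
  assumes "p \<in> polynomial_functions" shows "zariski_open {x. p x \<noteq> 0}"
  unfolding zariski_open_def zariski_closed_def using assms
  by (intro exI[of _ "{p}"]) auto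

text \<open>
  The complements of hypersurfaces form a basis of the Zariski topology, so a single polynomial
  witnesses that a property is generic.
\<close>

lemma generically_iff:
  "generically P \<longleftrightarrow> (\<exists>p\<in>polynomial_functions. (\<exists>x. p x \<noteq> 0) \<and> (\<forall>x. p x \<noteq> 0 \<longrightarrow> P x))"
proof
  assume "generically P"
  then obtain V x where "zariski_open V" "x \<in> V" and V: "\<forall>x\<in>V. P x"
    unfolding generically_def by blast
  then obtain A where "A \<subseteq> polynomial_functions" "- V = {x. \<forall>p\<in>A. p x = 0}"
    unfolding zariski_open_def zariski_closed_def by blast
  moreover from this \<open>x \<in> V\<close> obtain p where "p \<in> A" "p x \<noteq> 0" by blast
  ultimately show "\<exists>p\<in>polynomial_functions. (\<exists>x. p x \<noteq> 0) \<and> (\<forall>x. p x \<noteq> 0 \<longrightarrow> P x)"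
    using V by (intro bexI[of _ p]) blast+
next
  assume "\<exists>p\<in>polynomial_functions. (\<exists>x. p x \<noteq> 0) \<and> (\<forall>x. p x \<noteq> 0 \<longrightarrow> P x)"
  then show "generically P"
    unfolding generically_def using zariski_open_nonzero by blast
qed

lemma generically_mono: "generically P \<Longrightarrow> (\<And>x. P x \<Longrightarrow> Q x) \<Longrightarrow> generically Q"
  unfolding generically_def by blast

lemma generically_conj:
  assumes "generically P" "generically Q" shows "generically (\<lambda>x. P x \<and> Q x)"
proof -
  obtain p q x y where pq: "p \<in> polynomial_functions" "q \<in> polynomial_functions" "p x \<noteq> 0" "q y \<noteq> 0"
    and P: "\<forall>x. p x \<noteq> 0 \<longrightarrow> P x" and Q: "\<forall>x. q x \<noteq> 0 \<longrightarrow> Q x"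
    using assms unfolding generically_iff by blast
  obtain z where "p z \<noteq> 0" "q z \<noteq> 0" using polynomial_functions_common_nonzero[OF pq] by blast
  then show ?thesis using pq P Q
    unfolding generically_iff
    by (intro bexI[of _ "\<lambda>x. p x * q x"]) (auto intro: polynomial_functions.mult)
qed

section \<open>Functions regular on the complement of a hypersurface\<close>

text \<open>
  The functions regular on the set where \<open>g\<close> does not vanish, that is the localization of the
  ring of polynomial functions at the powers of \<open>g\<close>.  A single formula \<open>p / g^k\<close> has to be valid on
  the whole set, while the values outside of it are arbitrary.
\<close>

definition localization :: "('a::complex_affine \<Rightarrow> complex) \<Rightarrow> ('a \<Rightarrow> complex) set" where
  "localization g = {f. \<exists>p\<in>polynomial_functions. \<exists>k. \<forall>x. g x \<noteq> 0 \<longrightarrow> f x = p x / g x ^ k}"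

lemma localizationI:
  "p \<in> polynomial_functions \<Longrightarrow> (\<And>x. g x \<noteq> 0 \<Longrightarrow> f x = p x / g x ^ k) \<Longrightarrow> f \<in> localization g"
  unfolding localization_def by blast

lemma localization_polynomial: "p \<in> polynomial_functions \<Longrightarrow> p \<in> localization g"
  by (rule localizationI[where k = 0]) auto

lemma localization_one:
  "localization (\<lambda>x. 1) = (polynomial_functions :: ('a::complex_affine \<Rightarrow> complex) set)"
proof
  show "localization (\<lambda>x. 1) \<subseteq> (polynomial_functions :: ('a \<Rightarrow> complex) set)"
  proof
    fix f assume "f \<in> localization (\<lambda>x::'a. 1)"
    then obtain p where "p \<in> polynomial_functions" "\<And>x. f x = p x"
      by (auto simp: localization_def)
    moreover from this have "f = p" by blast
    ultimately show "f \<in> polynomial_functions" by simp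
  qed
qed (auto intro: localization_polynomial)

lemma localization_const: "(\<lambda>x. k) \<in> localization g"
  by (intro localization_polynomial polynomial_functions.const)

lemma localization_add:
  assumes "g \<in> polynomial_functions" "f \<in> localization g" "f' \<in> localization g"
  shows "(\<lambda>x. f x + f' x) \<in> localization g"
proof -
  obtain p k p' k' where "p \<in> polynomial_functions" "p' \<in> polynomial_functions"
    and "\<forall>x. g x \<noteq> 0 \<longrightarrow> f x = p x / g x ^ k" "\<forall>x. g x \<noteq> 0 \<longrightarrow> f' x = p' x / g x ^ k'"
    using assms unfolding localization_def by blast
  then show ?thesis using assms(1)
    by (intro localizationI[where p = "\<lambda>x. p x * g x ^ k' + p' x * g x ^ k" and k = "k + k'"])
      (auto intro!: polynomial_functions.add polynomial_functions.mult polynomial_functions_power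
        simp: field_simps power_add)
qed

lemma localization_mult:
  assumes "f \<in> localization g" "f' \<in> localization g"
  shows "(\<lambda>x. f x * f' x) \<in> localization g"
proof -
  obtain p k p' k' where "p \<in> polynomial_functions" "p' \<in> polynomial_functions"
    and "\<forall>x. g x \<noteq> 0 \<longrightarrow> f x = p x / g x ^ k" "\<forall>x. g x \<noteq> 0 \<longrightarrow> f' x = p' x / g x ^ k'"
    using assms unfolding localization_def by blast
  then show ?thesis
    by (intro localizationI[where p = "\<lambda>x. p x * p' x" and k = "k + k'"])
      (auto intro!: polynomial_functions.mult simp: power_add)
qed

lemma localization_diff:
  assumes "g \<in> polynomial_functions" "f \<in> localization g" "f' \<in> localization g"
  shows "(\<lambda>x. f x - f' x) \<in> localization g"
  using localization_add[OF assms(1,2) localization_mult[OF localization_const[of "-1"] assms(3)]]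
  by simp

lemma localization_cong:
  assumes "f \<in> localization g" "\<And>x. g x \<noteq> 0 \<Longrightarrow> f' x = f x"
  shows "f' \<in> localization g"
  using assms unfolding localization_def by auto

lemma polynomial_functions_diff:
  assumes "p \<in> polynomial_functions" "q \<in> polynomial_functions"
  shows "(\<lambda>x. p x - q x) \<in> polynomial_functions"
  using localization_diff[of "\<lambda>x. 1" p q] assms
  by (simp add: localization_one polynomial_functions.const)

lemma polynomial_functions_if:
  "p \<in> polynomial_functions \<Longrightarrow> q \<in> polynomial_functions \<Longrightarrow>
    (\<lambda>x. if b then p x else q x) \<in> polynomial_functions"
  by (cases b) simp_all

lemma localization_sum:
  "g \<in> polynomial_functions \<Longrightarrow> (\<And>i. i \<in> I \<Longrightarrow> f i \<in> localization g) \<Longrightarrow>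
    (\<lambda>x. \<Sum>i\<in>I. f i x) \<in> localization g"
  by (induction I rule: infinite_finite_induct) (auto intro: localization_const localization_add)

lemma localization_prod:
  "(\<And>i. i \<in> I \<Longrightarrow> f i \<in> localization g) \<Longrightarrow> (\<lambda>x. \<Prod>i\<in>I. f i x) \<in> localization g"
  by (induction I rule: infinite_finite_induct) (auto intro: localization_const localization_mult)

lemma localization_det:
  assumes "g \<in> polynomial_functions" "\<And>i j. (\<lambda>x. M x $ i $ j) \<in> localization g"
  shows "(\<lambda>x. det (M x)) \<in> localization g"
  unfolding det_def using assms
  by (intro localization_sum localization_mult localization_const localization_prod)

text \<open>
  A regular function becomes invertible after removing its zeros.  Writing \<open>f = p / g^k\<close>, the zeros
  are removed by passing from \<open>g\<close> to \<open>h = g p\<close>.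
\<close>

lemma localization_invert:
  assumes g: "g \<in> polynomial_functions" and f: "f \<in> localization g"
  obtains h where "h \<in> polynomial_functions" "\<And>x. h x \<noteq> 0 \<longleftrightarrow> g x \<noteq> 0 \<and> f x \<noteq> 0"
    "localization g \<subseteq> localization h" "(\<lambda>x. 1 / f x) \<in> localization h"
proof -
  obtain p k where p: "p \<in> polynomial_functions" "\<And>x. g x \<noteq> 0 \<Longrightarrow> f x = p x / g x ^ k"
    using f unfolding localization_def by blast
  define h where "h x = g x * p x" for x
  show thesis
  proof
    show "h \<in> polynomial_functions"
      unfolding h_def[abs_def] using g p by (intro polynomial_functions.mult)
    show "h x \<noteq> 0 \<longleftrightarrow> g x \<noteq> 0 \<and> f x \<noteq> 0" for x
      using p by (auto simp: h_def)
    show "localization g \<subseteq> localization h"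
    proof
      fix q assume "q \<in> localization g"
      then obtain r m where r: "r \<in> polynomial_functions" "\<And>x. g x \<noteq> 0 \<Longrightarrow> q x = r x / g x ^ m"
        unfolding localization_def by blast
      then show "q \<in> localization h"
        using p by (intro localizationI[where p = "\<lambda>x. r x * p x ^ m" and k = m])
          (auto simp: h_def power_mult_distrib intro!: polynomial_functions.mult polynomial_functions_power)
    qed
    show "(\<lambda>x. 1 / f x) \<in> localization h"
      using p g by (intro localizationI[where p = "\<lambda>x. g x ^ Suc k" and k = 1])
        (auto simp: h_def intro!: polynomial_functions_power polynomial_functions.mult)
  qed
qed

lemma localization_compose:
  assumes "q \<in> polynomial_functions" "g \<in> polynomial_functions"
    and "\<And>c. c \<in> coordinates \<Longrightarrow> (\<lambda>x. c (F x)) \<in> localization g"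
  shows "(\<lambda>x. q (F x)) \<in> localization g"
  using assms(1)
  by induction (auto intro: assms(2,3) localization_const localization_add localization_mult)

lemma polynomial_functions_compose:
  assumes "q \<in> polynomial_functions"
    and "\<And>c. c \<in> coordinates \<Longrightarrow> (\<lambda>x. c (F x)) \<in> polynomial_functions"
  shows "(\<lambda>x. q (F x)) \<in> polynomial_functions"
  using localization_compose[of q "\<lambda>x. 1" F] assms
  by (simp add: localization_one polynomial_functions.const)

lemma localization_pullback:
  assumes "f \<in> localization g"
    and F: "\<And>c. c \<in> coordinates \<Longrightarrow> (\<lambda>x. c (F x)) \<in> polynomial_functions"
  shows "(\<lambda>x. f (F x)) \<in> localization (\<lambda>x. g (F x))"
proof -
  obtain p k where p: "p \<in> polynomial_functions" "\<And>x. g x \<noteq> 0 \<Longrightarrow> f x = p x / g x ^ k"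
    using assms unfolding localization_def by blast
  have "(\<lambda>x. p (F x)) \<in> polynomial_functions"
    using p(1) F by (rule polynomial_functions_compose)
  then show ?thesis
    by (rule localizationI[where k = k]) (simp add: p(2))
qed

lemma regular_on_localization:
  assumes "g \<in> polynomial_functions"
    and F: "\<And>c. c \<in> coordinates \<Longrightarrow> (\<lambda>x. c (F x)) \<in> localization g"
    and V: "\<And>x. x \<in> V \<Longrightarrow> g x \<noteq> 0 \<and> f x = F x"
  shows "regular_on V f"
  unfolding regular_on_def
proof (intro ballI)
  fix c :: "'b \<Rightarrow> complex" and x assume c: "c \<in> coordinates" and "x \<in> V"
  then obtain p k where "p \<in> polynomial_functions" "\<And>x. g x \<noteq> 0 \<Longrightarrow> c (F x) = p x / g x ^ k"
    using F[OF c] unfolding localization_def by blast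
  then show "\<exists>p\<in>polynomial_functions. \<exists>q\<in>polynomial_functions.
     q x \<noteq> 0 \<and> (\<forall>y\<in>V. q y \<noteq> 0 \<longrightarrow> c (f y) = p y / q y)"
    using V \<open>x \<in> V\<close> assms(1)
    by (intro bexI[of _ p] bexI[of _ "\<lambda>x. g x ^ k"] polynomial_functions_power) auto
qed

section \<open>Involutions regular on a principal open set\<close>

text \<open>
  An involution of the set where \<open>g\<close> does not vanish that is regular there.  Being an involution of
  this set makes the map dominant, so generic properties can be pulled back along it.
\<close>

locale rational_involution =
  fixes g :: "'a::complex_affine \<Rightarrow> complex" and F :: "'a \<Rightarrow> 'a"
  assumes polynomial: "g \<in> polynomial_functions"
    and nonempty: "\<exists>x. g x \<noteq> 0"
    and regular: "c \<in> coordinates \<Longrightarrow> (\<lambda>x. c (F x)) \<in> localization g"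
    and preserves: "g x \<noteq> 0 \<Longrightarrow> g (F x) \<noteq> 0"
    and involution: "g x \<noteq> 0 \<Longrightarrow> F (F x) = x"
begin

lemma generically_domain: "generically (\<lambda>x. g x \<noteq> 0)"
  unfolding generically_iff using polynomial nonempty by blast

text \<open>
  The set where \<open>h\<close> does not vanish has a Zariski open preimage.  The preimage is nonempty since it
  contains the image of any point at which \<open>g\<close> and \<open>h\<close> are both nonzero.
\<close>

lemma pullback_nonzero:
  assumes h: "h \<in> polynomial_functions" "\<exists>x. h x \<noteq> 0"
  obtains h' where "h' \<in> polynomial_functions" "\<exists>x. h' x \<noteq> 0"
    "\<And>x. h' x \<noteq> 0 \<longleftrightarrow> g x \<noteq> 0 \<and> h (F x) \<noteq> 0"
proof -
  have "(\<lambda>x. h (F x)) \<in> localization g"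
    using localization_compose h(1) polynomial regular .
  then obtain h' where h': "h' \<in> polynomial_functions"
    and *: "\<And>x. h' x \<noteq> 0 \<longleftrightarrow> g x \<noteq> 0 \<and> h (F x) \<noteq> 0"
    by (rule localization_invert[OF polynomial]) blast
  obtain y where "g y \<noteq> 0" "h y \<noteq> 0"
    using polynomial_functions_common_nonzero polynomial nonempty h by blast
  then have "h' (F y) \<noteq> 0"
    by (simp add: * preserves involution)
  then show thesis
    using that h' * by blast
qed

lemma generically_comp:
  assumes "generically P" shows "generically (\<lambda>x. P (F x))"
proof -
  obtain h where h: "h \<in> polynomial_functions" "\<exists>x. h x \<noteq> 0" "\<forall>x. h x \<noteq> 0 \<longrightarrow> P x"
    using assms unfolding generically_iff by blast
  obtain h' where "h' \<in> polynomial_functions" "\<exists>x. h' x \<noteq> 0"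
    "\<And>x. h' x \<noteq> 0 \<longleftrightarrow> g x \<noteq> 0 \<and> h (F x) \<noteq> 0"
    using pullback_nonzero h by blast
  then show ?thesis
    using h unfolding generically_iff by blast
qed

text \<open>
  The open set on which the representative \<open>f\<close> agrees with \<open>F\<close> need not be invariant; intersecting
  it with its preimage under \<open>F\<close> makes it so, and there \<open>f\<close> is its own inverse.
\<close>

lemma birational_representative:
  assumes "generically (\<lambda>x. f x = F x)"
  shows "birational f"
proof -
  obtain h where h: "h \<in> polynomial_functions" "\<exists>x. h x \<noteq> 0" and f: "\<And>x. h x \<noteq> 0 \<Longrightarrow> f x = F x"
    using assms unfolding generically_iff by blast
  obtain h' where h': "h' \<in> polynomial_functions" "\<exists>x. h' x \<noteq> 0"
    "\<And>x. h' x \<noteq> 0 \<longleftrightarrow> g x \<noteq> 0 \<and> h (F x) \<noteq> 0"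
    using pullback_nonzero h by blast
  \<comment> \<open>The points \<open>x\<close> of the domain such that \<open>f\<close> agrees with \<open>F\<close> both at \<open>x\<close> and at \<open>F x\<close>.\<close>
  define V where "V = {x. h x * h' x \<noteq> 0}"
  have V: "x \<in> V \<longleftrightarrow> g x \<noteq> 0 \<and> h x \<noteq> 0 \<and> h (F x) \<noteq> 0" for x
    by (auto simp: V_def h'(3))
  have open_V: "zariski_open V"
    unfolding V_def by (intro zariski_open_nonzero polynomial_functions.mult h h')
  have ne: "V \<noteq> {}"
    using polynomial_functions_common_nonzero[OF h(1) h'(1)] h(2) h'(2) by (auto simp: V_def)
  have reg: "regular_on V f"
    using polynomial regular by (rule regular_on_localization) (auto simp: V f)
  have maps: "f x \<in> V" "f (f x) = x" if "x \<in> V" for x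
    using that by (auto simp: V f preserves involution)
  show ?thesis
    unfolding birational_def
    by (rule exI[of _ V], rule exI[of _ V], rule exI[of _ f]) (auto simp: open_V ne reg maps)
qed

end

lemma rational_involution_sigma1:
  fixes F :: "'a::complex_affine \<times> 'a \<Rightarrow> 'a \<times> 'a"
  assumes "rational_involution g F"
  shows "rational_involution (\<lambda>(x, y, z). g (x, y)) (sigma1 F)"
proof -
  interpret rational_involution g F by fact
  define \<pi> where "\<pi> t = (fst t, fst (snd t))" for t :: "'a \<times> 'a \<times> 'a"
  have \<pi>_poly: "(\<lambda>t. c (\<pi> t)) \<in> polynomial_functions" if "c \<in> coordinates" for c
    using that
    by (intro polynomial_functions.coordinate) (auto simp: coordinates_prod_def \<pi>_def image_iff o_def)
  have g: "(\<lambda>(x, y, z). g (x, y)) = (\<lambda>t. g (\<pi> t))"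
    by (auto simp: \<pi>_def)
  have F: "sigma1 F t = (fst (F (\<pi> t)), snd (F (\<pi> t)), snd (snd t))" for t
    by (simp add: sigma1_def \<pi>_def case_prod_unfold Let_def)
  have \<pi>F: "\<pi> (sigma1 F t) = F (\<pi> t)" for t
    by (simp add: F \<pi>_def)
  have reg: "(\<lambda>t. c (F (\<pi> t))) \<in> localization (\<lambda>t. g (\<pi> t))" if "c \<in> coordinates" for c
    using localization_pullback[OF regular[OF that] \<pi>_poly] .
  show ?thesis
    unfolding g
  proof
    show "(\<lambda>t. g (\<pi> t)) \<in> polynomial_functions"
      using polynomial \<pi>_poly by (rule polynomial_functions_compose)
    show "\<exists>t. g (\<pi> t) \<noteq> 0"
      using nonempty by (auto simp: \<pi>_def)
    show "g (\<pi> (sigma1 F t)) \<noteq> 0" if "g (\<pi> t) \<noteq> 0" for t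
      using preserves[OF that] by (simp add: \<pi>F)
    show "sigma1 F (sigma1 F t) = t" if "g (\<pi> t) \<noteq> 0" for t
      using involution[OF that] by (simp add: F[of "sigma1 F t"] \<pi>F) (simp add: F \<pi>_def prod_eq_iff)
    fix c :: "'a \<times> 'a \<times> 'a \<Rightarrow> complex" assume "c \<in> coordinates"
    then consider d where "d \<in> coordinates" "c = (\<lambda>t. d (fst t))"
      | d where "d \<in> coordinates" "c = (\<lambda>t. d (fst (snd t)))"
      | d where "d \<in> coordinates" "c = (\<lambda>t. d (snd (snd t)))"
      by (auto simp: coordinates_prod_def o_def)
    then show "(\<lambda>t. c (sigma1 F t)) \<in> localization (\<lambda>t. g (\<pi> t))"
    proof cases
      case 1
      then show ?thesis
        using reg[of "d \<circ> fst"] by (simp add: coordinates_prod_def F o_def)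
    next
      case 2
      then show ?thesis
        using reg[of "d \<circ> snd"] by (simp add: coordinates_prod_def F o_def)
    next
      case 3
      then show ?thesis
        using \<open>c \<in> coordinates\<close>
        by (auto simp: F intro: localization_polynomial polynomial_functions.coordinate)
    qed
  qed
qed

lemma rational_involution_sigma2:
  fixes F :: "'a::complex_affine \<times> 'a \<Rightarrow> 'a \<times> 'a"
  assumes "rational_involution g F"
  shows "rational_involution (\<lambda>(x, y, z). g (y, z)) (sigma2 F)"
proof -
  interpret rational_involution g F by fact
  have snd_poly: "(\<lambda>t. c (snd t)) \<in> polynomial_functions" if "c \<in> coordinates"
    for c :: "'a \<times> 'a \<Rightarrow> complex"
    using that
    by (intro polynomial_functions.coordinate) (auto simp: coordinates_prod_def[where 'b = "'a \<times> 'a"] o_def)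
  have g: "(\<lambda>(x, y, z). g (y, z)) = (\<lambda>t :: 'a \<times> 'a \<times> 'a. g (snd t))"
    by auto
  have F: "sigma2 F t = (fst t, F (snd t))" for t
    by (simp add: sigma2_def case_prod_unfold Let_def)
  have reg: "(\<lambda>t. c (F (snd t))) \<in> localization (\<lambda>t. g (snd t))" if "c \<in> coordinates" for c
    using localization_pullback[OF regular[OF that] snd_poly] .
  show ?thesis
    unfolding g
  proof
    show "(\<lambda>t. g (snd t)) \<in> polynomial_functions"
      using polynomial snd_poly by (rule polynomial_functions_compose)
    show "\<exists>t. g (snd t) \<noteq> 0"
      using nonempty by auto
    show "g (snd (sigma2 F t)) \<noteq> 0" if "g (snd t) \<noteq> 0" for t
      using preserves[OF that] by (simp add: F)
    show "sigma2 F (sigma2 F t) = t" if "g (snd t) \<noteq> 0" for t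
      using involution[OF that] by (simp add: F)
    fix c :: "'a \<times> 'a \<times> 'a \<Rightarrow> complex" assume "c \<in> coordinates"
    then consider d where "d \<in> coordinates" "c = (\<lambda>t. d (fst t))"
      | d where "d \<in> coordinates" "c = (\<lambda>t. d (snd t))"
      by (auto simp: coordinates_prod_def[where 'b = "'a \<times> 'a"] o_def)
    then show "(\<lambda>t. c (sigma2 F t)) \<in> localization (\<lambda>t. g (snd t))"
    proof cases
      case 1
      then show ?thesis
        using \<open>c \<in> coordinates\<close>
        by (auto simp: F intro: localization_polynomial polynomial_functions.coordinate)
    next
      case 2
      then show ?thesis
        using reg by (simp add: F)
    qed
  qed
qed

lemma generically_first_pair:
  fixes P :: "'a::complex_affine \<times> 'b::complex_affine \<Rightarrow> bool"
  assumes "generically P" shows "generically (\<lambda>(x, y, z :: 'c::complex_affine). P (x, y))"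
proof -
  obtain p a b where p: "p \<in> polynomial_functions" "p (a, b) \<noteq> 0" "\<forall>x. p x \<noteq> 0 \<longrightarrow> P x"
    using assms unfolding generically_iff by auto
  have "(\<lambda>t :: 'a \<times> 'b \<times> 'c. p (fst t, fst (snd t))) \<in> polynomial_functions"
    by (rule polynomial_functions_compose[OF p(1)], rule polynomial_functions.coordinate)
      (auto simp: coordinates_prod_def image_iff o_def)
  then show ?thesis
    using p unfolding generically_iff by (intro bexI) (auto intro: exI[of _ a] exI[of _ b])
qed

lemma generically_last_pair:
  fixes P :: "'b::complex_affine \<times> 'c::complex_affine \<Rightarrow> bool"
  assumes "generically P" shows "generically (\<lambda>(x :: 'a::complex_affine, y, z). P (y, z))"
proof -
  obtain p a b where p: "p \<in> polynomial_functions" "p (a, b) \<noteq> 0" "\<forall>x. p x \<noteq> 0 \<longrightarrow> P x"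
    using assms unfolding generically_iff by auto
  have "(\<lambda>t :: 'a \<times> 'b \<times> 'c. p (snd t)) \<in> polynomial_functions"
    by (rule polynomial_functions_compose[OF p(1)], rule polynomial_functions.coordinate)
      (auto simp: coordinates_prod_def[where 'b = "'b \<times> 'c"] o_def)
  then show ?thesis
    using p unfolding generically_iff by (intro bexI) (auto intro: exI[of _ a] exI[of _ b])
qed

section \<open>Eigenvectors in invariant subspaces\<close>

text \<open>
  The vector \<open>p(a) v\<close>, evaluated by Horner's scheme.
\<close>

definition apply_poly :: "complex ^ 'n ^ 'n \<Rightarrow> complex poly \<Rightarrow> complex ^ 'n \<Rightarrow> complex ^ 'n" where
  "apply_poly a p v = fold_coeffs (\<lambda>c w. c *s v + a *v w) p 0"

lemma apply_poly_0 [simp]: "apply_poly a 0 v = 0"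
  by (simp add: apply_poly_def)

lemma apply_poly_pCons [simp]: "apply_poly a (pCons c p) v = c *s v + a *v apply_poly a p v"
  by (cases "c = 0 \<and> p = 0") (auto simp: apply_poly_def)

lemma apply_poly_add: "apply_poly a (p + q) v = apply_poly a p v + apply_poly a q v"
  by (induction p q rule: poly_induct2)
    (simp_all add: matrix_vector_right_distrib vec.scale_left_distrib)

lemma apply_poly_smult: "apply_poly a (smult k p) v = k *s apply_poly a p v"
  by (induction p) (simp_all add: vec.scale_right_distrib vec.scale)

lemma apply_poly_linear_factor:
  "apply_poly a ([:- z, 1:] * q) v = a *v apply_poly a q v - z *s apply_poly a q v"
proof -
  have "[:- z, 1:] * q = pCons 0 q + smult (- z) q" by simp
  then show ?thesis by (simp only: apply_poly_add apply_poly_smult) simp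
qed

lemma apply_poly_monom: "apply_poly a (monom c i) v = c *s (((*v) a ^^ i) v)"
  by (induction i) (simp_all add: monom_0 monom_Suc vec.scale)

lemma apply_poly_sum: "apply_poly a (\<Sum>i\<in>I. p i) v = (\<Sum>i\<in>I. apply_poly a (p i) v)"
  by (induction I rule: infinite_finite_induct) (simp_all add: apply_poly_add)

text \<open>
  The first \<open>m + 1\<close> vectors of the sequence \<open>v\<close>, \<open>a v\<close>, \<open>a\<^sup>2 v\<close>, \<open>\<dots>\<close> in a space of dimension \<open>m\<close>
  either repeat or are linearly dependent.
\<close>

lemma annihilating_poly_exists:
  fixes a :: "complex ^ 'n ^ 'n"
  shows "\<exists>p. p \<noteq> 0 \<and> apply_poly a p v = 0"
proof -
  define f where "f i = ((*v) a ^^ i) v" for i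
  have act: "apply_poly a (monom c i) v = c *s f i" for c i
    by (simp add: apply_poly_monom f_def)
  show ?thesis
  proof (cases "inj_on f {..CARD('n)}")
    case False
    then obtain i j where "f i = f j" "i \<noteq> j" by (auto simp: inj_on_def)
    have "apply_poly a (monom 1 i + monom (- 1) j) v = 0"
      using \<open>f i = f j\<close> by (simp add: apply_poly_add act)
    moreover have "coeff (monom 1 i + monom (- 1) j :: complex poly) i = 1"
      using \<open>i \<noteq> j\<close> by simp
    then have "monom 1 i + monom (- 1) j \<noteq> (0 :: complex poly)"
      by (metis coeff_0 zero_neq_one)
    ultimately show ?thesis by blast
  next
    case True
    then have "card (f ` {..CARD('n)}) = Suc CARD('n)" by (simp add: card_image)
    then have "\<not> vec.independent (f ` {..CARD('n)})"
      using vec.independent_bound_general[of "f ` {..CARD('n)}"] vec.dim_subset_UNIV[of "f ` {..CARD('n)}"]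
      by (auto simp: vec.dimension_def card_cart_basis)
    then obtain u where u: "\<exists>w\<in>f ` {..CARD('n)}. u w \<noteq> 0" "(\<Sum>w\<in>f ` {..CARD('n)}. u w *s w) = 0"
      by (subst (asm) vec.dependent_finite) auto
    define p where "p = (\<Sum>i\<le>CARD('n). monom (u (f i)) i)"
    have "apply_poly a p v = (\<Sum>i\<le>CARD('n). u (f i) *s f i)"
      by (simp add: p_def apply_poly_sum act)
    also have "\<dots> = 0"
      using u(2) by (simp add: sum.reindex[OF True] o_def)
    finally have "apply_poly a p v = 0" .
    moreover from u obtain i where "i \<le> CARD('n)" "u (f i) \<noteq> 0" by auto
    then have "coeff p i \<noteq> 0" by (simp add: p_def coeff_sum)
    then have "p \<noteq> 0" by auto
    ultimately show ?thesis by blast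
  qed
qed

text \<open>
  Let \<open>p\<close> be a nonzero polynomial of least degree such that \<open>p(a) v = 0\<close>.  It has a root \<open>z\<close>, and
  with \<open>p = (x - z) q\<close> the vector \<open>q(a) v\<close> is an eigenvector by minimality.
\<close>

lemma eigenvector_in_invariant_subspace:
  fixes a :: "complex ^ 'n ^ 'n"
  assumes S: "vec.subspace S" "\<And>w. w \<in> S \<Longrightarrow> a *v w \<in> S" and v: "v \<in> S" "v \<noteq> 0"
  obtains w z where "w \<in> S" "w \<noteq> 0" "a *v w = z *s w"
proof -
  define A where "A p \<longleftrightarrow> p \<noteq> 0 \<and> apply_poly a p v = 0" for p
  have "\<exists>p. A p" unfolding A_def by (rule annihilating_poly_exists)
  then obtain p where p: "A p" and least: "\<And>q. A q \<Longrightarrow> degree p \<le> degree q"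
    using ex_has_least_nat[of A _ degree] by blast
  have "degree p \<noteq> 0"
  proof
    assume "degree p = 0"
    then obtain c where "p = [:c:]" using degree_eq_zeroE by blast
    with p v(2) show False by (auto simp: A_def)
  qed
  then have "\<not> constant (poly p)" by (simp add: constant_degree)
  then obtain z where "poly p z = 0" using fundamental_theorem_of_algebra by blast
  then obtain q where q: "p = [:- z, 1:] * q" by (metis poly_eq_0_iff_dvd dvdE)
  then have "q \<noteq> 0" using p by (auto simp: A_def)
  then have "degree p = Suc (degree q)" by (simp add: q degree_mult_eq del: mult_pCons_left)
  then have "\<not> A q" using least by fastforce
  then have "apply_poly a q v \<noteq> 0" using \<open>q \<noteq> 0\<close> by (simp add: A_def)
  moreover have "a *v apply_poly a q v = z *s apply_poly a q v"
    using p unfolding A_def q apply_poly_linear_factor by simp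
  moreover have "apply_poly a q v \<in> S"
    by (induction q) (auto intro!: vec.subspace_add[OF S(1)] vec.subspace_scale[OF S(1)] S(2) v vec.subspace_0[OF S(1)])
  ultimately show thesis by (rule that[rotated])
qed

section \<open>Similar matrices and intertwiners\<close>

definition similar :: "complex ^ 'n ^ 'n \<Rightarrow> complex ^ 'n ^ 'n \<Rightarrow> bool" where
  "similar a b \<longleftrightarrow> (\<exists>P. invertible P \<and> a ** P = P ** b)"

lemma similar_sym: "similar a b \<Longrightarrow> similar b a"
  unfolding similar_def invertible_def
  by (metis matrix_mul_assoc matrix_mul_lid matrix_mul_rid)

lemma similar_trans: "similar a b \<Longrightarrow> similar b c \<Longrightarrow> similar a c"
  unfolding similar_def
  by (metis invertible_mult matrix_mul_assoc)

lemma similar_eigenvalues_subset: "similar a b \<Longrightarrow> eigenvalues b \<subseteq> eigenvalues a"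
proof
  fix z assume "similar a b" "z \<in> eigenvalues b"
  then obtain P v where P: "invertible P" "a ** P = P ** b" and v: "v \<noteq> 0" "b *v v = z *s v"
    unfolding similar_def eigenvalues_def by blast
  have "a *v (P *v v) = P *v (b *v v)" by (simp add: matrix_vector_mul_assoc P(2))
  also have "\<dots> = z *s (P *v v)" by (simp add: v vec.scale)
  finally show "z \<in> eigenvalues a"
    using v(1) inj_matrix_vector_mult[OF P(1)] unfolding eigenvalues_def inj_def
    by (metis (mono_tags, lifting) matrix_vector_mult_0_right mem_Collect_eq)
qed

lemma similar_eigenvalues: "similar a b \<Longrightarrow> eigenvalues a = eigenvalues b"
  by (simp add: similar_eigenvalues_subset similar_sym subset_antisym)

text \<open>
  This is disjointness of the two spectra in a form that enters computations directly and is
  invariant under similarity in both arguments.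
\<close>

definition intertwiner_free :: "complex ^ 'n ^ 'n \<Rightarrow> complex ^ 'n ^ 'n \<Rightarrow> bool" where
  "intertwiner_free a b \<longleftrightarrow> (\<forall>X. a ** X = X ** b \<longrightarrow> X = 0)"

lemma intertwiner_free_similar_left:
  assumes "intertwiner_free a b" "similar a a'" shows "intertwiner_free a' b"
  unfolding intertwiner_free_def
proof (intro allI impI)
  fix X assume X: "a' ** X = X ** b"
  obtain P Q where P: "P ** Q = mat 1" "Q ** P = mat 1" "a ** P = P ** a'"
    using assms(2) unfolding similar_def invertible_def by blast
  have "a ** (P ** X) = (P ** X) ** b"
    by (metis X P(3) matrix_mul_assoc)
  then have "P ** X = 0" using assms(1) unfolding intertwiner_free_def by blast
  then have "Q ** (P ** X) = 0" by simp
  then show "X = 0" by (simp add: matrix_mul_assoc P)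
qed

lemma intertwiner_free_similar_right:
  assumes "intertwiner_free a b" "similar b b'" shows "intertwiner_free a b'"
  unfolding intertwiner_free_def
proof (intro allI impI)
  fix X assume X: "a ** X = X ** b'"
  obtain P Q where P: "P ** Q = mat 1" "Q ** P = mat 1" "b' ** P = P ** b"
    using similar_sym[OF assms(2)] unfolding similar_def invertible_def by blast
  have "a ** (X ** P) = (X ** P) ** b"
    by (metis X P(3) matrix_mul_assoc)
  then have "X ** P = 0" using assms(1) unfolding intertwiner_free_def by blast
  then have "(X ** P) ** Q = 0" by simp
  then show "X = 0" by (simp flip: matrix_mul_assoc add: P)
qed

lemma eigenvalues_transpose: "z \<in> eigenvalues a \<Longrightarrow> \<exists>v. v \<noteq> 0 \<and> transpose a *v v = z *s v"
proof -
  assume "z \<in> eigenvalues a"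
  then obtain v where v: "v \<noteq> 0" "a *v v = z *s v" unfolding eigenvalues_def by blast
  have m: "(b - mat z) *v w = b *v w - z *s w" for b :: "complex^'n^'n" and w
    by (simp add: matrix_vector_mult_diff_rdistrib)
       (simp add: vec_eq_iff matrix_vector_mult_def mat_def if_distrib if_distribR cong: if_cong)
  have "\<not> invertible (a - mat z)"
    using v m[of a v] inj_matrix_vector_mult[of "a - mat z"] unfolding inj_def
    by (metis cancel_comm_monoid_add_class.diff_cancel matrix_vector_mult_0_right)
  then have "det (transpose (a - mat z)) = 0" by (simp add: invertible_det_nz)
  moreover have "transpose (a - mat z) = transpose a - mat z"
    by (simp add: transpose_def mat_def vec_eq_iff)
  ultimately have "\<not> invertible (transpose a - mat z)" by (simp add: invertible_det_nz)
  then have "\<exists>v. v \<noteq> 0 \<and> (transpose a - mat z) *v v = 0"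
    using matrix_left_invertible_ker invertible_left_inverse by blast
  then show ?thesis by (auto simp: m)
qed

text \<open>
  An eigenvector \<open>v\<close> of \<open>a\<close> and a left eigenvector \<open>w\<close> of \<open>b\<close> for the same eigenvalue yield the
  nonzero intertwiner \<open>v w\<^sup>T\<close>.
\<close>

lemma intertwiner_free_eigenvalues_disjoint:
  assumes "intertwiner_free a b" shows "eigenvalues a \<inter> eigenvalues b = {}"
proof (rule ccontr)
  assume "eigenvalues a \<inter> eigenvalues b \<noteq> {}"
  then obtain z v w where v: "v \<noteq> 0" "a *v v = z *s v" and w: "w \<noteq> 0" "transpose b *v w = z *s w"
    using eigenvalues_transpose unfolding eigenvalues_def by blast
  define X where "X = (\<chi> i j. v $ i * w $ j)"
  have "(a ** X) $ i $ j = (a *v v) $ i * w $ j" for i j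
    by (simp add: X_def matrix_matrix_mult_def matrix_vector_mult_def sum_distrib_left mult_ac)
  moreover have "(X ** b) $ i $ j = v $ i * (transpose b *v w) $ j" for i j
    by (simp add: X_def matrix_matrix_mult_def matrix_vector_mult_def transpose_def sum_distrib_left mult_ac)
  moreover have "w v* b = z *s w" using w(2) by simp
  ultimately have "a ** X = X ** b" by (simp add: vec_eq_iff v mult_ac)
  then have "X = 0" using assms unfolding intertwiner_free_def by blast
  then show False using v(1) w(1) by (auto simp: X_def vec_eq_iff)
qed

section \<open>Factorizations of matrix polynomials into linear factors\<close>

lemma matrix_add_rdistrib: "(A + B) ** C = A ** C + B ** (C :: 'a::semiring_1 ^ 'n ^ 'm)"
  by (simp add: vec_eq_iff matrix_matrix_mult_def distrib_right sum.distrib)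

lemma matrix_diff_ldistrib: "A ** (B - C) = A ** B - A ** (C :: 'a::ring_1 ^ 'n ^ 'm)"
  by (simp add: vec_eq_iff matrix_matrix_mult_def right_diff_distrib sum_subtractf)

lemma matrix_diff_rdistrib: "(A - B) ** C = A ** C - B ** (C :: 'a::ring_1 ^ 'n ^ 'm)"
  by (simp add: vec_eq_iff matrix_matrix_mult_def left_diff_distrib sum_subtractf)

lemmas matrix_distribs =
  matrix_add_ldistrib matrix_add_rdistrib matrix_diff_ldistrib matrix_diff_rdistrib

text \<open>
  Substituting \<open>c2\<close> from the right into \<open>(t - b1) (t - b2) = (t - c1) (t - c2)\<close> gives zero on the
  right-hand side, so that \<open>c2 - b2\<close> intertwines \<open>c2\<close> and \<open>b1\<close>.
\<close>

lemma quadratic_factorization_unique: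
  fixes b1 :: "complex ^ 'n ^ 'n"
  assumes "b1 + b2 = c1 + c2" "b1 ** b2 = c1 ** c2" "intertwiner_free b1 c2"
  shows "b1 = c1 \<and> b2 = c2"
proof -
  define X where "X = c2 - b2"
  have "X ** c2 - b1 ** X = c2 ** c2 - (b1 + b2) ** c2 + b1 ** b2"
    by (simp add: X_def matrix_distribs)
  also have "\<dots> = 0"
    by (simp add: assms(1,2) matrix_distribs)
  finally have "X = 0"
    using assms(3) unfolding intertwiner_free_def by simp
  then show ?thesis using assms(1) by (simp add: X_def)
qed

text \<open>
  The substitution of \<open>c3\<close> from the right into \<open>(t - b1) (t - b2) (t - b3)\<close> is the same argument
  applied twice: one factor after the other is cancelled from the left.
\<close>

lemma cubic_factorization_unique:
  fixes b1 :: "complex ^ 'n ^ 'n"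
  assumes sum: "b1 + b2 + b3 = c1 + c2 + c3"
    and pairs: "b1 ** b2 + b1 ** b3 + b2 ** b3 = c1 ** c2 + c1 ** c3 + c2 ** c3"
    and prod: "b1 ** b2 ** b3 = c1 ** c2 ** c3"
    and free: "intertwiner_free b1 c3" "intertwiner_free b2 c3" "intertwiner_free b1 c2"
  shows "b1 = c1 \<and> b2 = c2 \<and> b3 = c3"
proof -
  define X where "X = c3 - b3"
  define Y where "Y = X ** c3 - b2 ** X"
  \<comment> \<open>Both sides are the value of \<open>(t - b1) (t - b2) (t - b3)\<close> at \<open>c3\<close>, with the powers of
    the variable written to the right of the coefficients.\<close>
  have "Y ** c3 - b1 ** Y = c3 ** c3 ** c3 - (b1 + b2 + b3) ** c3 ** c3
      + (b1 ** b2 + b1 ** b3 + b2 ** b3) ** c3 - b1 ** b2 ** b3"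
    by (simp add: X_def Y_def matrix_distribs matrix_mul_assoc)
  also have "\<dots> = 0"
    unfolding sum pairs prod by (simp add: matrix_distribs matrix_mul_assoc)
  finally have "Y = 0"
    using free(1) unfolding intertwiner_free_def by simp
  then have "X = 0"
    using free(2) unfolding intertwiner_free_def Y_def by simp
  then have "b3 = c3" by (simp add: X_def)
  moreover from this sum have *: "b1 + b2 = c1 + c2" by simp
  moreover have "b1 ** b2 = c1 ** c2"
  proof -
    have "b1 ** b2 = (b1 ** b2 + b1 ** b3 + b2 ** b3) - (b1 + b2) ** b3"
      by (simp add: matrix_distribs)
    also have "\<dots> = (c1 ** c2 + c1 ** c3 + c2 ** c3) - (c1 + c2) ** c3"
      by (simp only: pairs *, simp only: \<open>b3 = c3\<close>)
    also have "\<dots> = c1 ** c2"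
      by (simp add: matrix_distribs)
    finally show ?thesis .
  qed
  ultimately show ?thesis
    using quadratic_factorization_unique free(3) by blast
qed

section \<open>The Sylvester equation\<close>

text \<open>
  The matrix of the operator that maps \<open>X\<close> to \<open>a X - X b\<close>, with the entries of \<open>X\<close> indexed by pairs.
\<close>

definition sylvester :: "'a::ring_1 ^ 'n ^ 'n \<Rightarrow> 'a ^ 'n ^ 'n \<Rightarrow> 'a ^ ('n \<times> 'n) ^ ('n \<times> 'n)" where
  "sylvester a b = (\<chi> r s. (if snd r = snd s then a $ fst r $ fst s else 0)
     - (if fst r = fst s then b $ snd s $ snd r else 0))"

definition flatten :: "'a ^ 'n ^ 'n \<Rightarrow> 'a ^ ('n \<times> 'n)" where
  "flatten X = (\<chi> r. X $ fst r $ snd r)"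

lemma flatten_eq_iff: "flatten X = flatten Y \<longleftrightarrow> X = Y"
  by (auto simp: flatten_def vec_eq_iff)

lemma flatten_surj: "\<exists>X. x = flatten X"
  by (rule exI[of _ "\<chi> i j. x $ (i, j)"]) (simp add: flatten_def vec_eq_iff)

lemma sylvester_flatten:
  fixes a :: "'a::comm_ring_1 ^ 'n ^ 'n"
  shows "sylvester a b *v flatten X = flatten (a ** X - X ** b)"
proof -
  have "(sylvester a b *v flatten X) $ (i, j) = (a ** X - X ** b) $ i $ j" for i j
  proof -
    have "(sylvester a b *v flatten X) $ (i, j) =
      (\<Sum>k\<in>UNIV. \<Sum>l\<in>UNIV. ((if j = l then a $ i $ k else 0) - (if i = k then b $ l $ j else 0)) * X $ k $ l)"
      unfolding matrix_vector_mult_def sylvester_def flatten_def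
      by (simp add: sum.cartesian_product case_prod_unfold cong: if_cong flip: UNIV_Times_UNIV)
    also have "\<dots> = (\<Sum>k\<in>UNIV. \<Sum>l\<in>UNIV. if j = l then a $ i $ k * X $ k $ l else 0)
        - (\<Sum>k\<in>UNIV. if i = k then \<Sum>l\<in>UNIV. b $ l $ j * X $ k $ l else 0)"
      unfolding sum_subtractf[symmetric]
      by (intro sum.cong refl) (auto simp: left_diff_distrib sum_subtractf mult_delta_left)
    also have "\<dots> = (a ** X - X ** b) $ i $ j"
      by (simp add: matrix_matrix_mult_def mult_ac)
    finally show ?thesis .
  qed
  then show ?thesis by (simp add: vec_eq_iff flatten_def)
qed

lemma det_sylvester_nonzero_iff: "det (sylvester a b) \<noteq> 0 \<longleftrightarrow> intertwiner_free a b"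
proof -
  have "det (sylvester a b) \<noteq> 0 \<longleftrightarrow> (\<forall>x. sylvester a b *v x = 0 \<longrightarrow> x = 0)"
    by (metis invertible_det_nz invertible_left_inverse matrix_left_invertible_ker)
  also have "\<dots> \<longleftrightarrow> (\<forall>X. sylvester a b *v flatten X = 0 \<longrightarrow> flatten X = 0)"
    by (metis flatten_surj)
  also have "\<dots> \<longleftrightarrow> (\<forall>X. flatten (a ** X - X ** b) = flatten 0 \<longrightarrow> flatten X = flatten 0)"
    by (simp add: sylvester_flatten) (simp add: flatten_def zero_vec_def)
  also have "\<dots> \<longleftrightarrow> intertwiner_free a b"
    by (simp add: flatten_eq_iff intertwiner_free_def)
  finally show ?thesis .
qed

text \<open>
  Cramer's rule for the equation \<open>a X - X b = 1\<close>.
\<close>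

definition sylvester_cramer :: "'a::field ^ 'n ^ 'n \<Rightarrow> 'a ^ 'n ^ 'n \<Rightarrow> 'a ^ 'n ^ 'n" where
  "sylvester_cramer a b = (\<chi> i j.
     det (\<chi> r s. if s = (i, j) then flatten (mat 1) $ r else sylvester a b $ r $ s)
       / det (sylvester a b))"

lemma sylvester_solution_iff:
  assumes "intertwiner_free a b"
  shows "a ** X - X ** b = mat 1 \<longleftrightarrow> X = sylvester_cramer a b"
proof -
  have "a ** X - X ** b = mat 1 \<longleftrightarrow> sylvester a b *v flatten X = flatten (mat 1)"
    by (simp add: sylvester_flatten flatten_eq_iff)
  also have "\<dots> \<longleftrightarrow> flatten X = flatten (sylvester_cramer a b)"
    using assms unfolding det_sylvester_nonzero_iff[symmetric]
    by (subst cramer) (simp_all add: sylvester_cramer_def flatten_def)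
  finally show ?thesis by (simp add: flatten_eq_iff)
qed

lemma matrix_inv_eqI:
  fixes A :: "complex ^ 'n ^ 'n"
  assumes "A ** B = mat 1" shows "matrix_inv A = B"
proof -
  have "B ** A = mat 1" using assms by (simp add: matrix_left_right_inverse)
  have "A ** matrix_inv A = mat 1 \<and> matrix_inv A ** A = mat 1"
    unfolding matrix_inv_def
    by (rule someI[where x = B]) (simp add: assms \<open>B ** A = mat 1\<close>)
  then have "B ** (A ** matrix_inv A) = B" by simp
  then show ?thesis by (simp add: matrix_mul_assoc \<open>B ** A = mat 1\<close>)
qed

lemma matrix_inv_cramer:
  fixes A :: "complex ^ 'n ^ 'n"
  assumes "det A \<noteq> 0"
  shows "matrix_inv A = (\<chi> i j. det (\<chi> r s. if s = i then axis j 1 $ r else A $ r $ s) / det A)"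
    (is "_ = ?B")
proof (rule matrix_inv_eqI)
  have "A *v (\<chi> k. ?B $ k $ j) = axis j 1" for j
    using cramer[OF assms] by simp
  moreover have "(A ** ?B) $ i $ j = (A *v (\<chi> k. ?B $ k $ j)) $ i" for i j
    by (simp add: matrix_matrix_mult_def matrix_vector_mult_def)
  ultimately show "A ** ?B = mat 1"
    by (simp add: vec_eq_iff mat_def axis_def)
qed

lemma matrix_inv_invertible:
  fixes A :: "complex ^ 'n ^ 'n"
  assumes "invertible A" shows "A ** matrix_inv A = mat 1" "matrix_inv A ** A = mat 1"
  using assms matrix_inv_eqI unfolding invertible_def by metis+

section \<open>The exchange of two matrices\<close>

lemma coordinates_matrix:
  "(coordinates :: (complex ^ 'n ^ 'm \<Rightarrow> complex) set) = {c. \<exists>i j. c = (\<lambda>v. v $ i $ j)}"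
  by (simp add: coordinates_vec_def coordinates_complex_def image_UN) blast

lemma polynomial_entry_fst:
  "(\<lambda>a :: (complex ^ 'n ^ 'm) \<times> 'b::complex_affine. fst a $ i $ j) \<in> polynomial_functions"
  by (rule polynomial_functions.coordinate) (auto simp: coordinates_prod_def coordinates_matrix image_iff o_def)

lemma polynomial_entry_snd:
  "(\<lambda>a :: 'b::complex_affine \<times> (complex ^ 'n ^ 'm). snd a $ i $ j) \<in> polynomial_functions"
  by (rule polynomial_functions.coordinate) (auto simp: coordinates_prod_def coordinates_matrix image_iff o_def)

text \<open>
  The explicit formula for the twisted transposition, with \<open>\<Lambda>\<close> given by Cramer's rule so that its
  entries are visibly rational functions.
\<close>

definition exchange ::
    "(complex ^ 'n ^ 'n) \<times> (complex ^ 'n ^ 'n) \<Rightarrow> (complex ^ 'n ^ 'n) \<times> (complex ^ 'n ^ 'n)" where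
  "exchange = (\<lambda>(a1, a2). (a1 + matrix_inv (sylvester_cramer a2 a1), a2 - matrix_inv (sylvester_cramer a2 a1)))"

text \<open>
  The exchange swaps the two similarity classes.  Requiring the absence of intertwiners in both
  directions makes its invariance under the exchange evident.
\<close>

definition admissible :: "(complex ^ 'n ^ 'n) \<times> (complex ^ 'n ^ 'n) \<Rightarrow> bool" where
  "admissible = (\<lambda>(a1, a2). intertwiner_free a1 a2 \<and> intertwiner_free a2 a1 \<and>
     invertible (sylvester_cramer a2 a1))"

text \<open>
  Similarity implies equality of spectra and, being preserved along a sequence of exchanges, carries
  the absence of intertwiners from the original matrices to the final ones.
\<close>

definition exchanged ::
    "(complex ^ 'n ^ 'n) \<times> (complex ^ 'n ^ 'n) \<Rightarrow> (complex ^ 'n ^ 'n) \<times> (complex ^ 'n ^ 'n) \<Rightarrow> bool" where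
  "exchanged = (\<lambda>(a1, a2) (b1, b2). b1 + b2 = a1 + a2 \<and> b1 ** b2 = a1 ** a2 \<and>
     similar b1 a2 \<and> similar b2 a1)"

text \<open>
  The first two identities say that the factors are conjugate to \<open>a2\<close> and \<open>a1\<close>.  For the product,
  the Sylvester equation is multiplied by \<open>D\<close> on both sides, giving \<open>D a2 - a1 D = D\<^sup>2\<close>.
\<close>

lemma exchange_from_solution:
  fixes a1 :: "complex ^ 'n ^ 'n"
  assumes L: "a2 ** L - L ** a1 = mat 1" and D: "L ** D = mat 1" "D ** L = mat 1"
  shows "L ** (a1 + D) = a2 ** L" "(a2 - D) ** L = L ** a1" "(a1 + D) ** (a2 - D) = a1 ** a2"
proof -
  have a2L: "a2 ** L = L ** a1 + mat 1" using L by (simp add: algebra_simps)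
  show "L ** (a1 + D) = a2 ** L" by (simp add: a2L matrix_distribs D)
  show "(a2 - D) ** L = L ** a1" by (simp add: a2L matrix_distribs D)
  have "D ** (a2 ** L - L ** a1) ** D = D ** D" by (simp add: L)
  then have "D ** a2 ** (L ** D) - (D ** L) ** a1 ** D = D ** D"
    by (simp add: matrix_distribs matrix_mul_assoc)
  then have "D ** a2 - a1 ** D = D ** D" by (simp add: D)
  then show "(a1 + D) ** (a2 - D) = a1 ** a2"
    by (simp add: matrix_distribs algebra_simps)
qed

text \<open>
  For the new pair \<open>- \<Lambda>\<close> solves the Sylvester equation, which makes the exchange an involution.
\<close>

lemma admissible_exchange:
  fixes a :: "(complex ^ 'n ^ 'n) \<times> (complex ^ 'n ^ 'n)"
  assumes "admissible a"
  shows "exchanged a (exchange a)" "admissible (exchange a)" "exchange (exchange a) = a"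
proof -
  obtain a1 a2 where a: "a = (a1, a2)" by (cases a)
  define L where "L = sylvester_cramer a2 a1"
  define D where "D = matrix_inv L"
  have free: "intertwiner_free a1 a2" "intertwiner_free a2 a1" and inv: "invertible L"
    using assms by (auto simp: a admissible_def L_def)
  have LD: "L ** D = mat 1" "D ** L = mat 1"
    using matrix_inv_invertible[OF inv] by (simp_all add: D_def)
  have L: "a2 ** L - L ** a1 = mat 1"
    using sylvester_solution_iff[OF free(2)] by (simp add: L_def)
  define b1 where "b1 = a1 + D"
  define b2 where "b2 = a2 - D"
  have e: "exchange a = (b1, b2)"
    by (simp add: a exchange_def b1_def b2_def D_def L_def)
  note * = exchange_from_solution[OF L LD, folded b1_def b2_def]
  have sim: "similar b1 a2" "similar b2 a1"
    using similar_sym[of a2 b1] *(1,2) inv unfolding similar_def by metis+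
  show "exchanged a (exchange a)"
    unfolding e unfolding a exchanged_def using sim *(3) by (simp add: b1_def b2_def)
  have free_b: "intertwiner_free b1 b2" "intertwiner_free b2 b1"
    using free sim by (meson intertwiner_free_similar_left intertwiner_free_similar_right similar_sym)+
  have minus: "A ** (- L) = - (A ** L)" "(- L) ** A = - (L ** A)" "L ** (- A) = - (L ** A)"
    for A :: "complex ^ 'n ^ 'n"
    by (simp_all add: vec_eq_iff matrix_matrix_mult_def sum_negf)
  have "b2 ** (- L) - (- L) ** b1 = mat 1"
    using *(1,2) L by (simp add: minus)
  then have L': "sylvester_cramer b2 b1 = - L"
    using sylvester_solution_iff[OF free_b(2)] by simp
  have "(- L) ** (- D) = mat 1" by (simp add: minus LD)
  then have inv': "matrix_inv (- L) = - D" "invertible (- L)"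
    using matrix_inv_eqI invertible_right_inverse by blast+
  show "admissible (exchange a)"
    unfolding e admissible_def by (simp add: free_b L' inv')
  show "exchange (exchange a) = a"
    unfolding e unfolding exchange_def prod.case L' inv' by (simp add: a b1_def b2_def)
qed

lemma exchanged_imp_swap_factors: "exchanged a b \<Longrightarrow> swap_factors a b"
  by (auto simp: exchanged_def swap_factors_def dest!: similar_eigenvalues)

text \<open>
  With \<open>D = b1 - a1\<close> the product relation reads \<open>D a2 = b1 D\<close>.  A nonzero kernel of \<open>D\<close> would
  contain an eigenvector of \<open>a2\<close>; since \<open>b2\<close> agrees with \<open>a2\<close> there, its eigenvalue would be shared
  by \<open>a2\<close> and \<open>b2\<close>, whose spectrum is that of \<open>a1\<close>.
\<close>

lemma swap_factors_sylvester_solution: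
  fixes a1 :: "complex ^ 'n ^ 'n"
  assumes free: "intertwiner_free a2 a1"
    and swap: "swap_factors (a1, a2) (b1, b2)"
  shows "\<exists>L. a2 ** L - L ** a1 = mat 1 \<and> invertible L \<and> (b1, b2) = (a1 + matrix_inv L, a2 - matrix_inv L)"
proof -
  define D where "D = b1 - a1"
  have b: "b1 = a1 + D" "b2 = a2 - D"
    using swap by (auto simp: swap_factors_def D_def algebra_simps)
  have "b1 ** b2 = a1 ** a2" using swap by (simp add: swap_factors_def)
  then have D: "D ** a2 = b1 ** D"
    by (simp add: b matrix_distribs algebra_simps)
  have "\<forall>v. D *v v = 0 \<longrightarrow> v = 0"
  proof (rule ccontr)
    assume "\<not> (\<forall>v. D *v v = 0 \<longrightarrow> v = 0)"
    then obtain v where v: "D *v v = 0" "v \<noteq> 0" by blast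
    have sub: "vec.subspace {v. D *v v = 0}"
      by (auto simp: vec.subspace_def matrix_vector_right_distrib vec.scale)
    have "D *v (a2 *v w) = 0" if "D *v w = 0" for w
      using that by (metis D matrix_vector_mul_assoc matrix_vector_mult_0_right)
    then obtain w z where w: "D *v w = 0" "w \<noteq> 0" "a2 *v w = z *s w"
      using eigenvector_in_invariant_subspace[OF sub, of a2 v] v by auto
    then have "b2 *v w = z *s w" by (simp add: b matrix_vector_mult_diff_rdistrib)
    then have "z \<in> eigenvalues a2 \<inter> eigenvalues b2" using w by (auto simp: eigenvalues_def)
    then show False
      using swap intertwiner_free_eigenvalues_disjoint[OF free] by (auto simp: swap_factors_def)
  qed
  then have "invertible D"
    by (simp add: invertible_left_inverse matrix_left_invertible_ker)
  then have i: "D ** matrix_inv D = mat 1" "matrix_inv D ** D = mat 1"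
    by (rule matrix_inv_invertible)+
  define L where "L = matrix_inv D"
  have "L ** (D ** a2) ** L = L ** (a1 ** D + D ** D) ** L"
    by (simp add: D b matrix_distribs)
  then have "(L ** D) ** a2 ** L = L ** a1 ** (D ** L) + (L ** D) ** (D ** L)"
    by (simp add: matrix_distribs matrix_mul_assoc)
  then have "a2 ** L - L ** a1 = mat 1"
    using i by (simp add: L_def)
  moreover have "invertible L" "matrix_inv L = D"
    using i matrix_inv_eqI unfolding L_def invertible_def by blast+
  ultimately show ?thesis using b by blast
qed

lemma admissible_swap_factors_iff:
  assumes "admissible a" shows "swap_factors a b \<longleftrightarrow> b = exchange a"
proof
  assume "swap_factors a b"
  moreover obtain a1 a2 b1 b2 where "a = (a1, a2)" "b = (b1, b2)" by (metis surj_pair)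
  ultimately show "b = exchange a"
    using swap_factors_sylvester_solution[of a2 a1 b1 b2] sylvester_solution_iff[of a2 a1] assms
    by (auto simp: admissible_def exchange_def)
next
  assume "b = exchange a"
  then show "swap_factors a b"
    using admissible_exchange(1)[OF assms] exchanged_imp_swap_factors by blast
qed

text \<open>
  For this pair the Sylvester operator is the identity and \<open>\<Lambda> = 1\<close>.
\<close>

lemma admissible_nonempty: "admissible (0 :: complex ^ 'n ^ 'n, mat 1)"
proof -
  have free: "intertwiner_free (0 :: complex ^ 'n ^ 'n) (mat 1)" "intertwiner_free (mat 1 :: complex ^ 'n ^ 'n) 0"
    by (simp_all add: intertwiner_free_def)
  have "sylvester_cramer (mat 1) 0 = (mat 1 :: complex ^ 'n ^ 'n)"
    using sylvester_solution_iff[OF free(2), of "mat 1"] by simp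
  moreover have "invertible (mat 1 :: complex ^ 'n ^ 'n)"
    unfolding invertible_def by (rule exI[of _ "mat 1"]) simp
  ultimately show ?thesis using free by (simp add: admissible_def)
qed

lemma polynomial_sylvester_entry:
  "(\<lambda>a :: (complex ^ 'n ^ 'n) \<times> (complex ^ 'n ^ 'n). sylvester (snd a) (fst a) $ r $ s) \<in> polynomial_functions"
  "(\<lambda>a :: (complex ^ 'n ^ 'n) \<times> (complex ^ 'n ^ 'n). sylvester (fst a) (snd a) $ r $ s) \<in> polynomial_functions"
  by (auto simp: sylvester_def intro!: polynomial_functions_diff polynomial_functions_if
      polynomial_entry_fst polynomial_entry_snd polynomial_functions.const)

text \<open>
  Cramer's rule is applied twice, to the Sylvester operator and to its solution \<open>\<Lambda>\<close>.  Both
  determinants become invertible on the set of admissible pairs.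
\<close>

lemma exchange_localization:
  obtains g where "g \<in> polynomial_functions"
    "\<And>a :: (complex ^ 'n ^ 'n) \<times> (complex ^ 'n ^ 'n). g a \<noteq> 0 \<longleftrightarrow> admissible a"
    "\<And>c. c \<in> coordinates \<Longrightarrow> (\<lambda>a. c (exchange a)) \<in> localization g"
proof -
  let ?L = "\<lambda>a :: (complex ^ 'n ^ 'n) \<times> (complex ^ 'n ^ 'n). sylvester_cramer (snd a) (fst a)"
  have det_poly: "(\<lambda>a. det (M a)) \<in> polynomial_functions"
    if "\<And>r s. (\<lambda>a. M a $ r $ s) \<in> polynomial_functions"
    for M :: "(complex ^ 'n ^ 'n) \<times> (complex ^ 'n ^ 'n) \<Rightarrow> complex ^ ('n \<times> 'n) ^ ('n \<times> 'n)"
    using localization_det[of "\<lambda>x. 1" M] that by (simp add: localization_one polynomial_functions.const)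
  \<comment> \<open>The two factors encode the absence of intertwiners in the two directions.\<close>
  define p where "p a = det (sylvester (fst a) (snd a)) * det (sylvester (snd a) (fst a))"
    for a :: "(complex ^ 'n ^ 'n) \<times> (complex ^ 'n ^ 'n)"
  have p: "p \<in> polynomial_functions"
    unfolding p_def by (intro polynomial_functions.mult det_poly polynomial_sylvester_entry)
  have det1: "(\<lambda>a :: (complex ^ 'n ^ 'n) \<times> (complex ^ 'n ^ 'n).
      det (sylvester (fst a) (snd a))) \<in> polynomial_functions"
    by (intro det_poly polynomial_sylvester_entry)
  have "(\<lambda>a. ?L a $ i $ j) \<in> localization p" for i j
  proof -
    let ?N = "\<lambda>a :: (complex ^ 'n ^ 'n) \<times> (complex ^ 'n ^ 'n). det (\<chi> r s. if s = (i, j) then flatten (mat 1) $ r else sylvester (snd a) (fst a) $ r $ s)"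
    have "?N \<in> polynomial_functions"
    proof (rule det_poly)
      fix r s :: "'n \<times> 'n"
      show "(\<lambda>a :: (complex ^ 'n ^ 'n) \<times> (complex ^ 'n ^ 'n). (\<chi> r s. if s = (i, j) then flatten (mat 1) $ r else sylvester (snd a) (fst a) $ r $ s) $ r $ s)
          \<in> polynomial_functions"
        by (cases "s = (i, j)") (simp_all add: polynomial_functions.const polynomial_sylvester_entry)
    qed
    then have "(\<lambda>a. det (sylvester (fst a) (snd a)) * ?N a) \<in> polynomial_functions"
      by (intro polynomial_functions.mult det1)
    then show ?thesis
      by (rule localizationI[where k = 1]) (simp add: sylvester_cramer_def p_def)
  qed
  note L_entry = this
  then have "(\<lambda>a. det (?L a)) \<in> localization p"
    by (rule localization_det[OF p])
  then obtain g where g: "g \<in> polynomial_functions" "\<And>a. g a \<noteq> 0 \<longleftrightarrow> p a \<noteq> 0 \<and> det (?L a) \<noteq> 0"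
    and sub: "localization p \<subseteq> localization g" and inv: "(\<lambda>a. 1 / det (?L a)) \<in> localization g"
    by (rule localization_invert[OF p]) blast
  have inv_entry: "(\<lambda>a. matrix_inv (?L a) $ i $ j) \<in> localization g" for i j
  proof -
    let ?N = "\<lambda>a. det (\<chi> r s. if s = i then axis j 1 $ r else ?L a $ r $ s)"
    have "?N \<in> localization g"
    proof (rule localization_det[OF g(1)])
      fix r s
      show "(\<lambda>a. (\<chi> r s. if s = i then axis j 1 $ r else ?L a $ r $ s) $ r $ s) \<in> localization g"
        using L_entry sub by (cases "s = i") (auto simp: localization_const)
    qed
    then have "(\<lambda>a. ?N a * (1 / det (?L a))) \<in> localization g"
      using inv by (rule localization_mult)
    then show ?thesis
      by (rule localization_cong) (simp add: g matrix_inv_cramer)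
  qed
  show thesis
  proof
    show "g \<in> polynomial_functions" by (rule g)
    show "g a \<noteq> 0 \<longleftrightarrow> admissible a" for a
      unfolding g(2) p_def admissible_def
      by (auto simp: det_sylvester_nonzero_iff[symmetric] invertible_det_nz split: prod.split)
    fix c :: "(complex ^ 'n ^ 'n) \<times> (complex ^ 'n ^ 'n) \<Rightarrow> complex" assume "c \<in> coordinates"
    then consider i j where "c = (\<lambda>a. fst a $ i $ j)" | i j where "c = (\<lambda>a. snd a $ i $ j)"
      by (auto simp: coordinates_prod_def coordinates_matrix o_def)
    then show "(\<lambda>a. c (exchange a)) \<in> localization g"
    proof cases
      case 1
      then show ?thesis
        using localization_add[OF g(1) localization_polynomial[OF polynomial_entry_fst] inv_entry]
        by (simp add: exchange_def case_prod_unfold)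
    next
      case 2
      then show ?thesis
        using localization_diff[OF g(1) localization_polynomial[OF polynomial_entry_snd] inv_entry]
        by (simp add: exchange_def case_prod_unfold)
    qed
  qed
qed

section \<open>The braid relation\<close>

text \<open>
  Up to signs, the coefficients of \<open>(t - x) (t - y) (t - z)\<close> for a central variable \<open>t\<close>.
\<close>

definition cubic_coefficients ::
    "(complex ^ 'n ^ 'n) \<times> (complex ^ 'n ^ 'n) \<times> (complex ^ 'n ^ 'n) \<Rightarrow>
     (complex ^ 'n ^ 'n) \<times> (complex ^ 'n ^ 'n) \<times> (complex ^ 'n ^ 'n)" where
  "cubic_coefficients = (\<lambda>(x, y, z). (x + y + z, x ** y + x ** z + y ** z, x ** y ** z))"

lemma cubic_coefficients_exchanged:
  fixes z :: "complex ^ 'n ^ 'n"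
  shows
  "exchanged (x, y) (u, v) \<Longrightarrow> cubic_coefficients (u, v, z) = cubic_coefficients (x, y, z)"
  "exchanged (x, y) (u, v) \<Longrightarrow> cubic_coefficients (z, u, v) = cubic_coefficients (z, x, y)"
proof -
  have e1: "a ** b + a ** c + b ** c = a ** b + (a + b) ** c"
    and e2: "c ** a + c ** b + a ** b = c ** (a + b) + a ** b" for a b c :: "complex ^ 'n ^ 'n"
    by (simp_all add: matrix_distribs)
  assume "exchanged (x, y) (u, v)"
  then have "u + v = x + y" "u ** v = x ** y" by (simp_all add: exchanged_def)
  then show "cubic_coefficients (u, v, z) = cubic_coefficients (x, y, z)"
      "cubic_coefficients (z, u, v) = cubic_coefficients (z, x, y)"
    unfolding cubic_coefficients_def prod.case e1[of _ _ z] e2[of z]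
    by (simp_all add: add.assoc flip: matrix_mul_assoc)
qed

lemma exchanged_similar: "exchanged (x, y) (u, v) \<Longrightarrow> similar y u \<and> similar x v"
  by (auto simp: exchanged_def similar_sym)

text \<open>
  The hypotheses follow the three exchanges on each side of the braid relation.  Both results have
  the cubic coefficients of \<open>(a1, a2, a3)\<close> and factors similar to \<open>a3\<close>, \<open>a2\<close>, \<open>a1\<close>, so they agree.
\<close>

lemma exchange_braid:
  fixes a1 :: "complex ^ 'n ^ 'n"
  assumes b: "exchanged (a1, a2) (b1, b2)"
    and c: "exchanged (b2, a3) (c2, c3)"
    and d: "exchanged (b1, c2) (d1, d2)"
    and e: "exchanged (a2, a3) (e2, e3)"
    and f: "exchanged (a1, e2) (f1, f2)"
    and h: "exchanged (f2, e3) (h2, h3)"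
    and adm: "admissible (a1, a2)" "admissible (a2, a3)" "admissible (b2, a3)"
  shows "(d1, d2, c3) = (f1, h2, h3)"
proof -
  note sims = b c d e f h
  note sims = sims[THEN exchanged_similar]
  have left: "similar a3 d1" "similar a2 d2"
    using sims similar_trans by blast+
  have right: "similar a2 h2" "similar a1 h3"
    using sims similar_trans by blast+
  have "intertwiner_free a2 a1" "intertwiner_free a3 a2" "intertwiner_free a3 b2"
    using adm by (auto simp: admissible_def)
  moreover have "intertwiner_free a3 a1"
    using sims similar_sym calculation(3) intertwiner_free_similar_right by blast
  ultimately have free: "intertwiner_free d1 h3" "intertwiner_free d2 h3" "intertwiner_free d1 h2"
    using left right intertwiner_free_similar_left intertwiner_free_similar_right by blast+
  have "cubic_coefficients (d1, d2, c3) = cubic_coefficients (a1, a2, a3)"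
    by (simp only: cubic_coefficients_exchanged(1)[OF d] cubic_coefficients_exchanged(2)[OF c]
        cubic_coefficients_exchanged(1)[OF b])
  also have "\<dots> = cubic_coefficients (f1, h2, h3)"
    by (simp only: cubic_coefficients_exchanged(2)[OF h] cubic_coefficients_exchanged(1)[OF f]
        cubic_coefficients_exchanged(2)[OF e])
  finally show ?thesis
    using cubic_factorization_unique[of d1 d2 c3 f1 h2 h3, OF _ _ _ free]
    by (simp add: cubic_coefficients_def)
qed

theorem mainTheorem1:
  "generically (\<lambda>a :: (complex ^ 'n ^ 'n) \<times> (complex ^ 'n ^ 'n). \<exists>!b. swap_factors a b) \<and>
   generically (\<lambda>(a1 :: complex ^ 'n ^ 'n, a2). \<exists>!\<Lambda>. a2 ** \<Lambda> - \<Lambda> ** a1 = mat 1) \<and>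
   (\<forall>\<mu> :: (complex ^ 'n ^ 'n) \<times> (complex ^ 'n ^ 'n) \<Rightarrow> (complex ^ 'n ^ 'n) \<times> (complex ^ 'n ^ 'n).
      generically (\<lambda>a. swap_factors a (\<mu> a)) \<longrightarrow>
        twisted_transposition \<mu> \<and>
        generically (\<lambda>(a1, a2). \<forall>\<Lambda>. a2 ** \<Lambda> - \<Lambda> ** a1 = mat 1 \<longrightarrow>
          invertible \<Lambda> \<and> \<mu> (a1, a2) = (a1 + matrix_inv \<Lambda>, a2 - matrix_inv \<Lambda>)))"
proof (intro conjI allI impI)
  obtain g where g: "g \<in> polynomial_functions"
    "\<And>a :: (complex ^ 'n ^ 'n) \<times> (complex ^ 'n ^ 'n). g a \<noteq> 0 \<longleftrightarrow> admissible a"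
    "\<And>c. c \<in> coordinates \<Longrightarrow> (\<lambda>a. c (exchange a)) \<in> localization g"
    using exchange_localization by blast
  interpret E: rational_involution g exchange
    using g admissible_nonempty by unfold_locales (auto simp: admissible_exchange)
  interpret S1: rational_involution "\<lambda>(x, y, z). g (x, y)" "sigma1 exchange"
    by (rule rational_involution_sigma1) unfold_locales
  interpret S2: rational_involution "\<lambda>(x, y, z). g (y, z)" "sigma2 exchange"
    by (rule rational_involution_sigma2) unfold_locales
  have adm: "generically (admissible :: (complex ^ 'n ^ 'n) \<times> (complex ^ 'n ^ 'n) \<Rightarrow> bool)"
    using E.generically_domain by (simp add: g)
  show "generically (\<lambda>a :: (complex ^ 'n ^ 'n) \<times> (complex ^ 'n ^ 'n). \<exists>!b. swap_factors a b)"
    using adm by (rule generically_mono) (simp add: admissible_swap_factors_iff)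
  show "generically (\<lambda>(a1 :: complex ^ 'n ^ 'n, a2). \<exists>!\<Lambda>. a2 ** \<Lambda> - \<Lambda> ** a1 = mat 1)"
    using adm by (rule generically_mono) (auto simp: admissible_def sylvester_solution_iff)
  fix \<mu> :: "(complex ^ 'n ^ 'n) \<times> (complex ^ 'n ^ 'n) \<Rightarrow> (complex ^ 'n ^ 'n) \<times> (complex ^ 'n ^ 'n)"
  assume "generically (\<lambda>a. swap_factors a (\<mu> a))"
  from generically_conj[OF this adm]
  have \<mu>: "generically (\<lambda>a. \<mu> a = exchange a \<and> admissible a)"
    by (rule generically_mono) (auto simp: admissible_swap_factors_iff)
  show "generically (\<lambda>(a1, a2). \<forall>\<Lambda>. a2 ** \<Lambda> - \<Lambda> ** a1 = mat 1 \<longrightarrow>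
      invertible \<Lambda> \<and> \<mu> (a1, a2) = (a1 + matrix_inv \<Lambda>, a2 - matrix_inv \<Lambda>))"
    using \<mu> by (rule generically_mono) (auto simp: admissible_def sylvester_solution_iff exchange_def)
  \<comment> \<open>The points at which the given representative may be replaced by the explicit exchange.\<close>
  define ok1 where "ok1 = (\<lambda>(x, y, z :: complex ^ 'n ^ 'n). \<mu> (x, y) = exchange (x, y) \<and> admissible (x, y))"
  define ok2 where "ok2 = (\<lambda>(x :: complex ^ 'n ^ 'n, y, z). \<mu> (y, z) = exchange (y, z) \<and> admissible (y, z))"
  have ok: "generically ok1" "generically ok2"
    using generically_first_pair[OF \<mu>] generically_last_pair[OF \<mu>] by (simp_all add: ok1_def ok2_def)
  have sigma: "ok1 x \<Longrightarrow> sigma1 \<mu> x = sigma1 exchange x" "ok2 x \<Longrightarrow> sigma2 \<mu> x = sigma2 exchange x" for x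
    by (auto simp: ok1_def ok2_def sigma1_def sigma2_def)
  have inv: "ok1 x \<Longrightarrow> sigma1 exchange (sigma1 exchange x) = x"
    "ok2 x \<Longrightarrow> sigma2 exchange (sigma2 exchange x) = x" for x
    using S1.involution[of x] S2.involution[of x] by (cases x; simp add: ok1_def ok2_def g)+
  show "twisted_transposition \<mu>"
    unfolding twisted_transposition_def
  proof (intro conjI)
    show "birational \<mu>"
      using \<mu> by (intro E.birational_representative) (auto elim: generically_mono)
    show "generically (\<lambda>x. sigma1 \<mu> (sigma1 \<mu> x) = x)"
      using generically_conj[OF ok(1) S1.generically_comp[OF ok(1)]]
      by (rule generically_mono) (simp add: sigma inv)
    show "generically (\<lambda>x. sigma2 \<mu> (sigma2 \<mu> x) = x)"
      using generically_conj[OF ok(2) S2.generically_comp[OF ok(2)]]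
      by (rule generically_mono) (simp add: sigma inv)
    have "generically (\<lambda>x. (ok1 x \<and> ok2 (sigma1 exchange x) \<and> ok1 (sigma2 exchange (sigma1 exchange x))) \<and>
        (ok2 x \<and> ok1 (sigma2 exchange x) \<and> ok2 (sigma1 exchange (sigma2 exchange x))))"
      by (intro generically_conj ok S1.generically_comp[OF ok(2)] S2.generically_comp[OF ok(1)]
          S1.generically_comp[OF S2.generically_comp[OF ok(1)]] S2.generically_comp[OF S1.generically_comp[OF ok(2)]])
    then show "generically (\<lambda>x. sigma1 \<mu> (sigma2 \<mu> (sigma1 \<mu> x)) = sigma2 \<mu> (sigma1 \<mu> (sigma2 \<mu> x)))"
    proof (rule generically_mono)
      fix x assume x: "(ok1 x \<and> ok2 (sigma1 exchange x) \<and> ok1 (sigma2 exchange (sigma1 exchange x))) \<and>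
        (ok2 x \<and> ok1 (sigma2 exchange x) \<and> ok2 (sigma1 exchange (sigma2 exchange x)))"
      obtain a1 a2 a3 where a: "x = (a1, a2, a3)" by (cases x)
      obtain b1 b2 where b: "exchange (a1, a2) = (b1, b2)" by fastforce
      obtain c2 c3 where c: "exchange (b2, a3) = (c2, c3)" by fastforce
      obtain d1 d2 where d: "exchange (b1, c2) = (d1, d2)" by fastforce
      obtain e2 e3 where e: "exchange (a2, a3) = (e2, e3)" by fastforce
      obtain f1 f2 where f: "exchange (a1, e2) = (f1, f2)" by fastforce
      obtain h2 h3 where h: "exchange (f2, e3) = (h2, h3)" by fastforce
      note steps = b c d e f h
      have adm: "admissible (a1, a2)" "admissible (b2, a3)" "admissible (b1, c2)"
        "admissible (a2, a3)" "admissible (a1, e2)" "admissible (f2, e3)"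
        using x by (auto simp: a steps sigma1_def sigma2_def ok1_def ok2_def)
      have "(d1, d2, c3) = (f1, h2, h3)"
        using adm[THEN admissible_exchange(1)] adm unfolding steps by (intro exchange_braid)
      then show "sigma1 \<mu> (sigma2 \<mu> (sigma1 \<mu> x)) = sigma2 \<mu> (sigma1 \<mu> (sigma2 \<mu> x))"
        using x by (simp add: sigma) (simp add: a steps sigma1_def sigma2_def)
    qed
  qed
qed

end
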